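(* The cube graph $Q_3$ is not partially DP-nice, and $\alpha_2^{DP}(Q_3)=5$.
   Context: All graphs are nonempty, finite and simple. For $m\in\mathbb{N}=\{1,2,\dots\}$ write $[m]=\{1,\dots,m\}$. The cube graph $Q_3$ has as vertices all bit strings of length three, two being adjacent if and only if they differ in exactly one bit. For $S,U\subseteq V(H)$, $E_H(S,U)$ is the set of edges of $H$ with at least one endpoint in $S$ and at least one endpoint in $U$. A cover of a graph $G$ is a pair $\mathcal{H}=(L,H)$ where $H$ is a graph and $L:V(G)\to\mathcal{P}(V(H))$ satisfies: (1) the sets $L(u)$, $u\in V(G)$, partition $V(H)$; (2) $H[L(u)]$ is complete for every $u\in V(G)$; (3) for every $uv\in E(G)$, $E_H(L(u),L(v))$ is a (possibly empty) matching; (4) if $u\neq v$ and $uv\notin E(G)$, then $E_H(L(u),L(v))=\emptyset$. The cover is $m$-fold if $|L(u)|=m$ for all $u\in V(G)$. An $\mathcal{H}$-coloring of $G$ is an independent set of size $|V(G)|$ in $H$. The DP-chromatic number $\chi_{DP}(G)$ is the smallest $m$ such that $G$ has an $\mathcal{H}$-coloring for every $m$-fold cover $\mathcal{H}$ of $G$. For $t\in\mathbb{N}$, the partial DP $t$-chromatic number $\alpha_t^{DP}(G)$ is the minimum of $\alpha(H)$ (the independence number of $H$) over all $t$-fold covers $\mathcal{H}=(L,H)$ of $G$. A graph $G$ is partially DP-nice if $\alpha_t^{DP}(G)\ge t|V(G)|/\chi_{DP}(G)$ for all $t\in[\chi_{DP}(G)]$. *)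

theory Defs
  imports Complex_Main "HOL-Library.Ramsey" "HOL-Library.Disjoint_Sets"
begin

text \<open>A graph is a pair of a vertex set and a set of two-element vertex sets. Completeness and
  independence of vertex sets are \<open>clique\<close> and \<open>indep\<close> of \<open>HOL-Library.Ramsey\<close>.\<close>

type_synonym 'a graph = "'a set \<times> 'a set set"

abbreviation verts :: "'a graph \<Rightarrow> 'a set" where "verts \<equiv> fst"
abbreviation edges :: "'a graph \<Rightarrow> 'a set set" where "edges \<equiv> snd"

definition is_graph :: "'a graph \<Rightarrow> bool" where
  "is_graph G \<longleftrightarrow> finite (verts G) \<and> verts G \<noteq> {} \<and>
     (\<forall>e\<in>edges G. e \<subseteq> verts G \<and> card e = 2)"

definition indep_set :: "'a graph \<Rightarrow> 'a set \<Rightarrow> bool" where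
  "indep_set G S \<longleftrightarrow> S \<subseteq> verts G \<and> indep S (edges G)"

definition indep_number :: "'a graph \<Rightarrow> nat" where
  "indep_number G = Max (card ` {S. indep_set G S})"

definition edges_between :: "'a graph \<Rightarrow> 'a set \<Rightarrow> 'a set \<Rightarrow> 'a set set" where
  "edges_between G S U = {e \<in> edges G. e \<inter> S \<noteq> {} \<and> e \<inter> U \<noteq> {}}"

definition matching :: "'a set set \<Rightarrow> bool" where
  "matching M \<longleftrightarrow> (\<forall>e\<in>M. \<forall>e'\<in>M. e \<noteq> e' \<longrightarrow> e \<inter> e' = {})"

definition cube_graph :: "nat \<Rightarrow> bool list graph" where
  "cube_graph d =
     (let V = {x. length x = d}
      in (V, {{x, y} | x y. x \<in> V \<and> y \<in> V \<and> card {i. i < d \<and> x ! i \<noteq> y ! i} = 1}))"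

definition DP_cover :: "'a graph \<Rightarrow> ('a \<Rightarrow> 'b set) \<Rightarrow> 'b graph \<Rightarrow> bool" where
  "DP_cover G L H \<longleftrightarrow> is_graph H \<and>
     (\<Union>u\<in>verts G. L u) = verts H \<and> disjoint_family_on L (verts G) \<and>
     (\<forall>u\<in>verts G. clique (L u) (edges H)) \<and>
     (\<forall>u\<in>verts G. \<forall>v\<in>verts G. {u, v} \<in> edges G \<longrightarrow> matching (edges_between H (L u) (L v))) \<and>
     (\<forall>u\<in>verts G. \<forall>v\<in>verts G. u \<noteq> v \<and> {u, v} \<notin> edges G \<longrightarrow> edges_between H (L u) (L v) = {})"

definition fold_cover :: "nat \<Rightarrow> 'a graph \<Rightarrow> ('a \<Rightarrow> 'b set) \<Rightarrow> 'b graph \<Rightarrow> bool" where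
  "fold_cover m G L H \<longleftrightarrow> DP_cover G L H \<and> (\<forall>u\<in>verts G. card (L u) = m)"

definition cover_coloring :: "'a graph \<Rightarrow> 'b graph \<Rightarrow> 'b set \<Rightarrow> bool" where
  "cover_coloring G H I \<longleftrightarrow> indep_set H I \<and> card I = card (verts G)"

text \<open>Covers below range over graphs whose vertices are natural numbers. Covers being finite,
  this loses no generality: by lemma \<open>fold_cover_nat\<close> below, every cover, on any vertex type, has
  a copy of this kind with the same independence number and the same colorability.\<close>

definition DP_colorable :: "nat \<Rightarrow> 'a graph \<Rightarrow> bool" where
  "DP_colorable m G \<longleftrightarrow>
     (\<forall>(L :: 'a \<Rightarrow> nat set) H. fold_cover m G L H \<longrightarrow> (\<exists>I. cover_coloring G H I))"

definition DP_chromatic_number :: "'a graph \<Rightarrow> nat" where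
  "DP_chromatic_number G = (LEAST m. 1 \<le> m \<and> DP_colorable m G)"

definition partial_DP_number :: "nat \<Rightarrow> 'a graph \<Rightarrow> nat" where
  "partial_DP_number t G =
     (LEAST a. \<exists>(L :: 'a \<Rightarrow> nat set) H. fold_cover t G L H \<and> a = indep_number H)"

definition partially_DP_nice :: "'a graph \<Rightarrow> bool" where
  "partially_DP_nice G \<longleftrightarrow>
     (\<forall>t\<in>{1..DP_chromatic_number G}.
        real (partial_DP_number t G)
          \<ge> real t * real (card (verts G)) / real (DP_chromatic_number G))"

lemma is_graph_cube: "is_graph (cube_graph d)"
proof -
  have ne: "{x :: bool list. length x = d} \<noteq> {}"
    using length_replicate[of d True] by blast
  have fin: "finite {x :: bool list. length x = d}"
    using finite_lists_length_eq[of "UNIV :: bool set" d] by simp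
  have "card {x, y} = 2" if "card {i. i < d \<and> x ! i \<noteq> y ! i} = 1" for x y :: "bool list"
  proof -
    have "x \<noteq> y" using that by auto
    then show ?thesis by simp
  qed
  then show ?thesis
    unfolding is_graph_def cube_graph_def Let_def fst_conv snd_conv using ne fin by blast
qed

definition map_graph :: "('b \<Rightarrow> 'c) \<Rightarrow> 'b graph \<Rightarrow> 'c graph" where
  "map_graph f H = (f ` verts H, (`) f ` edges H)"

lemma map_graph_edge_iff:
  assumes "is_graph H" "inj_on f (verts H)" "A \<subseteq> verts H"
  shows "f ` A \<in> edges (map_graph f H) \<longleftrightarrow> A \<in> edges H"
  using assms by (auto simp: map_graph_def is_graph_def inj_on_image_eq_iff)

lemma indep_set_map_graph:
  assumes "is_graph H" "inj_on f (verts H)" "S \<subseteq> verts H"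
  shows "indep_set (map_graph f H) (f ` S) \<longleftrightarrow> indep_set H S"
proof -
  have "{f v, f w} \<in> edges (map_graph f H) \<longleftrightarrow> {v, w} \<in> edges H" if "v \<in> S" "w \<in> S" for v w
    using map_graph_edge_iff[OF assms(1,2), of "{v, w}"] that assms(3) by auto
  moreover have "f v = f w \<longleftrightarrow> v = w" if "v \<in> S" "w \<in> S" for v w
    using that assms(2,3) by (auto dest: inj_onD)
  moreover have "f ` S \<subseteq> verts (map_graph f H)"
    using assms(3) by (auto simp: map_graph_def)
  ultimately show ?thesis using assms(3) by (auto simp: indep_set_def indep_def)
qed

lemma card_indep_sets_map_graph:
  assumes "is_graph H" "inj_on f (verts H)"
  shows "card ` {S. indep_set (map_graph f H) S} = card ` {S. indep_set H S}"
proof -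
  have c: "card (f ` S) = card S" if "S \<subseteq> verts H" for S
    using that assms(2) by (meson card_image inj_on_subset)
  have "{S. indep_set (map_graph f H) S} = (`) f ` {S. indep_set H S}"
  proof (intro equalityI subsetI)
    fix T assume T: "T \<in> {S. indep_set (map_graph f H) S}"
    then obtain S where "S \<subseteq> verts H" "T = f ` S"
      by (auto simp: indep_set_def map_graph_def subset_image_iff)
    then show "T \<in> (`) f ` {S. indep_set H S}"
      using T indep_set_map_graph[OF assms] by auto
  next
    fix T assume "T \<in> (`) f ` {S. indep_set H S}"
    then show "T \<in> {S. indep_set (map_graph f H) S}"
      using indep_set_map_graph[OF assms] by (auto simp: indep_set_def)
  qed
  then show ?thesis
    using c by (force simp: image_image indep_set_def intro!: image_cong)
qed

lemma fold_cover_map_graph: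
  assumes "fold_cover m G L H" "inj_on f (verts H)"
  shows "fold_cover m G (\<lambda>u. f ` L u) (map_graph f H)"
proof -
  note d = assms(1)[unfolded fold_cover_def DP_cover_def]
  have g: "is_graph H" using d by blast
  have L: "L u \<subseteq> verts H" if "u \<in> verts G" for u using d that by blast
  have inj_im: "f ` A \<inter> f ` B = f ` (A \<inter> B)" if "A \<subseteq> verts H" "B \<subseteq> verts H" for A B
    using inj_on_image_Int[OF assms(2) that] by simp
  have E: "e \<subseteq> verts H" if "e \<in> edges H" for e using g that by (auto simp: is_graph_def)
  have between: "edges_between (map_graph f H) (f ` S) (f ` U) = (`) f ` edges_between H S U"
    if "S \<subseteq> verts H" "U \<subseteq> verts H" for S U
  proof -
    have "f ` e \<inter> f ` A \<noteq> {} \<longleftrightarrow> e \<inter> A \<noteq> {}" if "e \<in> edges H" "A \<subseteq> verts H" for e A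
      using inj_im[OF E[OF that(1)] that(2)] by simp
    then have "f ` e \<inter> f ` S \<noteq> {} \<and> f ` e \<inter> f ` U \<noteq> {} \<longleftrightarrow> e \<inter> S \<noteq> {} \<and> e \<inter> U \<noteq> {}"
      if "e \<in> edges H" for e
      using that \<open>S \<subseteq> verts H\<close> \<open>U \<subseteq> verts H\<close> by metis
    then have "edges_between (map_graph f H) (f ` S) (f ` U) =
        (`) f ` {e \<in> edges H. e \<inter> S \<noteq> {} \<and> e \<inter> U \<noteq> {}}"
      unfolding edges_between_def map_graph_def snd_conv by (intro set_eqI iffI) (fast, fast)
    then show ?thesis by (simp only: edges_between_def)
  qed
  have "is_graph (map_graph f H)"
    using g assms(2) by (auto simp: is_graph_def map_graph_def card_image inj_on_subset)
  moreover have "(\<Union>u\<in>verts G. f ` L u) = verts (map_graph f H)"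
    unfolding map_graph_def fst_conv using d by blast
  moreover have "disjoint_family_on (\<lambda>u. f ` L u) (verts G)"
    using d L by (simp add: disjoint_family_on_def inj_im)
  moreover have "clique (f ` L u) (edges (map_graph f H))" if "u \<in> verts G" for u
    unfolding clique_def
  proof (intro ballI impI)
    fix a b assume ab: "a \<in> f ` L u" "b \<in> f ` L u" "a \<noteq> b"
    then obtain x y where xy: "x \<in> L u" "y \<in> L u" "a = f x" "b = f y" "x \<noteq> y" by blast
    then have "{x, y} \<in> edges H" using d that by (auto simp: clique_def)
    then have "f ` {x, y} \<in> edges (map_graph f H)"
      unfolding map_graph_def snd_conv by (rule imageI)
    then show "{a, b} \<in> edges (map_graph f H)" using xy by simp
  qed
  moreover have "matching (edges_between (map_graph f H) (f ` L u) (f ` L v))"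
    if "u \<in> verts G" "v \<in> verts G" "{u, v} \<in> edges G" for u v
  proof -
    have m: "matching (edges_between H (L u) (L v))" using d that by blast
    have sub: "e \<subseteq> verts H" if "e \<in> edges_between H (L u) (L v)" for e
      using that E by (auto simp: edges_between_def)
    show ?thesis
      unfolding matching_def between[OF L[OF that(1)] L[OF that(2)]]
    proof (intro ballI impI)
      fix a b
      assume "a \<in> (`) f ` edges_between H (L u) (L v)" "b \<in> (`) f ` edges_between H (L u) (L v)"
        and ne: "a \<noteq> b"
      then obtain e e' where e: "e \<in> edges_between H (L u) (L v)" "a = f ` e"
        "e' \<in> edges_between H (L u) (L v)" "b = f ` e'" by blast
      then have "e \<inter> e' = {}" using m ne unfolding matching_def by blast
      then show "a \<inter> b = {}" using e inj_im[OF sub[OF e(1)] sub[OF e(3)]] by simp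
    qed
  qed
  moreover have "edges_between (map_graph f H) (f ` L u) (f ` L v) = {}"
    if "u \<in> verts G" "v \<in> verts G" "u \<noteq> v \<and> {u, v} \<notin> edges G" for u v
    using between[OF L[OF that(1)] L[OF that(2)]] d that by auto
  moreover have "card (f ` L u) = m" if "u \<in> verts G" for u
    using d that L[OF that] assms(2) by (metis card_image inj_on_subset)
  ultimately show ?thesis by (simp add: fold_cover_def DP_cover_def)
qed

lemma fold_cover_nat:
  fixes L :: "'a \<Rightarrow> 'b set"
  assumes "fold_cover m G L H"
  obtains L' :: "'a \<Rightarrow> nat set" and H' where "fold_cover m G L' H'"
    "indep_number H' = indep_number H"
    "(\<exists>I. cover_coloring G H' I) \<longleftrightarrow> (\<exists>I. cover_coloring G H I)"
proof -
  have g: "is_graph H" using assms by (simp add: fold_cover_def DP_cover_def)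
  then have "finite (verts H)" by (simp add: is_graph_def)
  then obtain f :: "'b \<Rightarrow> nat" where f: "inj_on f (verts H)"
    using finite_imp_inj_to_nat_seg[of "verts H"] by (metis (no_types))
  note c = card_indep_sets_map_graph[OF g f]
  have n: "(\<exists>I. cover_coloring G K I) \<longleftrightarrow> card (verts G) \<in> card ` {S. indep_set K S}"
    for K :: "nat graph"
    unfolding cover_coloring_def image_iff Bex_def mem_Collect_eq by metis
  have b: "(\<exists>I. cover_coloring G H I) \<longleftrightarrow> card (verts G) \<in> card ` {S. indep_set H S}"
    unfolding cover_coloring_def image_iff Bex_def mem_Collect_eq by metis
  show ?thesis
    by (rule that[OF fold_cover_map_graph[OF assms f]]) (simp_all only: indep_number_def n b c)
qed

end

theory Submission
  imports Defs
begin

text \<open>A \<open>t\<close>-fold cover is coloured greedily: a vertex with fewer than \<open>t\<close> coloured neighbours always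
  has a free colour. For \<open>t = 2\<close> this colours the five vertices of an induced forest of \<open>Q\<^sub>3\<close>.
  For \<open>t = 3\<close>, two neighbours of a vertex \<open>v\<close> are coloured first so that together they forbid at
  most one colour at \<open>v\<close>, and the greedy procedure then runs towards \<open>v\<close>; so the
  DP-chromatic number is at most 3. Conversely, the 2-fold cover of a signed \<open>Q\<^sub>3\<close> all of whose faces
  are unbalanced has no independent set of size 6: deleting two vertices of \<open>Q\<^sub>3\<close> leaves a whole
  face or, if they are antipodal, a hexagon, which is unbalanced as the sum of three faces.
  Finally \<open>5 < 2 \<cdot> 8 / 3\<close>.\<close>

section \<open>Independent sets and covers\<close>

lemma edge_ends:
  assumes "is_graph H" "{x, y} \<in> edges H"
  shows "x \<noteq> y" "x \<in> verts H" "y \<in> verts H"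
proof -
  have "card {x, y} = 2" "{x, y} \<subseteq> verts H" using assms by (auto simp: is_graph_def)
  then show "x \<noteq> y" "x \<in> verts H" "y \<in> verts H" by auto
qed

lemma finite_indep_sets:
  assumes "is_graph H"
  shows "finite {S. indep_set H S}"
  using assms by (auto simp: is_graph_def indep_set_def intro: finite_subset[of _ "Pow (verts H)"])

lemma card_le_indep_number:
  assumes "is_graph H" "indep_set H S"
  shows "card S \<le> indep_number H"
  using assms finite_indep_sets[OF assms(1)] by (auto simp: indep_number_def)

lemma indep_number_leI:
  assumes "is_graph H" "\<And>S. indep_set H S \<Longrightarrow> card S \<le> k"
  shows "indep_number H \<le> k"
proof -
  \<comment> \<open>The empty set guarantees that \<open>Max\<close> in \<open>indep_number\<close>
    ranges over a nonempty set.\<close>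
  have "indep_set H {}" by (simp add: indep_set_def indep_def)
  then have "card ` {S. indep_set H S} \<noteq> {}" by auto
  then show ?thesis
    unfolding indep_number_def using assms finite_indep_sets[OF assms(1)]
    by (intro Max.boundedI) auto
qed

lemma fold_coverD:
  assumes "fold_cover m G L H"
  shows "is_graph H" "u \<in> verts G \<Longrightarrow> card (L u) = m" "u \<in> verts G \<Longrightarrow> L u \<subseteq> verts H"
    "u \<in> verts G \<Longrightarrow> finite (L u)"
    "u \<in> verts G \<Longrightarrow> v \<in> verts G \<Longrightarrow> u \<noteq> v \<Longrightarrow> L u \<inter> L v = {}"
proof -
  show H: "is_graph H" using assms by (simp add: fold_cover_def DP_cover_def)
  show L: "L u \<subseteq> verts H" if "u \<in> verts G"
    using assms that by (auto simp: fold_cover_def DP_cover_def)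
  show "finite (L u)" if "u \<in> verts G"
    using H finite_subset[OF L[OF that]] by (simp add: is_graph_def)
  show "card (L u) = m" if "u \<in> verts G" using assms that by (simp add: fold_cover_def)
  show "L u \<inter> L v = {}" if "u \<in> verts G" "v \<in> verts G" "u \<noteq> v"
    using assms that by (simp add: fold_cover_def DP_cover_def disjoint_family_on_def)
qed

lemma cover_edge_adj:
  assumes "fold_cover m G L H" "u \<in> verts G" "v \<in> verts G" "u \<noteq> v" "x \<in> L u" "y \<in> L v"
    and "{x, y} \<in> edges H"
  shows "{u, v} \<in> edges G"
proof (rule ccontr)
  assume "{u, v} \<notin> edges G"
  then have "edges_between H (L u) (L v) = {}"
    using assms(1-4) by (simp add: fold_cover_def DP_cover_def)
  moreover have "{x, y} \<in> edges_between H (L u) (L v)"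
    using assms(5-7) by (auto simp: edges_between_def)
  ultimately show False by simp
qed

text \<open>The first edge already makes \<open>u\<close> and \<open>v\<close> adjacent, so the
  edges between their lists form a matching, in which two edges sharing \<open>x\<close>
  coincide.\<close>

lemma cover_edge_unique:
  assumes "fold_cover m G L H" "u \<in> verts G" "v \<in> verts G" "u \<noteq> v" "x \<in> L u"
    and "y \<in> L v" "{x, y} \<in> edges H" "y' \<in> L v" "{x, y'} \<in> edges H"
  shows "y = y'"
proof -
  have "matching (edges_between H (L u) (L v))"
    using assms(1-3) cover_edge_adj[OF assms(1-7)] by (simp add: fold_cover_def DP_cover_def)
  moreover have "{x, y} \<in> edges_between H (L u) (L v)" "{x, y'} \<in> edges_between H (L u) (L v)"
    using assms(5-9) by (auto simp: edges_between_def)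
  moreover have "{x, y} \<inter> {x, y'} \<noteq> {}" by simp
  ultimately have "{x, y} = {x, y'}" unfolding matching_def by meson
  then show ?thesis by (auto simp: doubleton_eq_iff)
qed

section \<open>Greedy colouring\<close>

text \<open>A choice function in place of an independent set, so that colouring one more vertex is a
  function update. Values outside \<open>U\<close> are arbitrary.\<close>

definition partial_coloring ::
    "'a graph \<Rightarrow> ('a \<Rightarrow> 'b set) \<Rightarrow> 'b graph \<Rightarrow> 'a set \<Rightarrow> ('a \<Rightarrow> 'b) \<Rightarrow> bool" where
  "partial_coloring G L H U f \<longleftrightarrow> finite U \<and> U \<subseteq> verts G \<and> (\<forall>u\<in>U. f u \<in> L u) \<and>
     (\<forall>u\<in>U. \<forall>v\<in>U. {f u, f v} \<notin> edges H)"

definition forbidden :: "('a \<Rightarrow> 'b set) \<Rightarrow> 'b graph \<Rightarrow> 'a \<Rightarrow> 'b \<Rightarrow> 'b set" where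
  "forbidden L H w x = {y \<in> L w. {x, y} \<in> edges H}"

text \<open>The matching condition leaves \<open>x\<close> at most one neighbour in
  \<open>L w\<close>, and none if \<open>u\<close> and \<open>w\<close> are not adjacent. In the
  \<open>of_bool\<close> form, summing over \<open>u\<close> counts coloured neighbours of
  \<open>w\<close>.\<close>

lemma card_forbidden_le:
  assumes "fold_cover m G L H" "u \<in> verts G" "w \<in> verts G" "u \<noteq> w" "x \<in> L u"
  shows "card (forbidden L H w x) \<le> of_bool ({u, w} \<in> edges G)"
proof (cases "forbidden L H w x = {}")
  case False
  then obtain y where y: "y \<in> L w" "{x, y} \<in> edges H" by (auto simp: forbidden_def)
  then have "forbidden L H w x = {y}"
    using y cover_edge_unique[OF assms y] unfolding forbidden_def by blast
  then show ?thesis using cover_edge_adj[OF assms y] by simp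
qed simp

text \<open>Lists of distinct vertices are disjoint, so \<open>f\<close> is injective on
  \<open>U\<close> and no element of the independent set is counted twice.\<close>

lemma partial_coloring_indep:
  assumes "fold_cover m G L H" "partial_coloring G L H U f"
  shows "indep_set H (f ` U)" "card (f ` U) = card U"
proof -
  note p = assms(2)[unfolded partial_coloring_def]
  show "indep_set H (f ` U)"
    using p fold_coverD(3)[OF assms(1)] by (auto simp: indep_set_def indep_def)
  have "inj_on f U"
  proof (rule inj_onI)
    fix u v assume uv: "u \<in> U" "v \<in> U" "f u = f v"
    then have "f u \<in> L u \<inter> L v" using p by auto
    then show "u = v" using fold_coverD(5)[OF assms(1), of u v] p uv by blast
  qed
  then show "card (f ` U) = card U" by (rule card_image)
qed

text \<open>The hypothesis bounds the union of the forbidden sets, not the number of coloured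
  neighbours: a vertex with \<open>m\<close> coloured neighbours can still be coloured when two of
  them forbid the same colour.\<close>

lemma partial_coloring_extend:
  assumes c: "fold_cover m G L H" and p: "partial_coloring G L H U f"
    and w: "w \<in> verts G" "w \<notin> U" and less: "card (\<Union>u\<in>U. forbidden L H w (f u)) < m"
  shows "\<exists>x. partial_coloring G L H (insert w U) (f(w := x))"
proof -
  have "(\<Union>u\<in>U. forbidden L H w (f u)) \<noteq> L w"
    using less fold_coverD(2)[OF c w(1)] by auto
  then obtain x where x: "x \<in> L w" "\<forall>u\<in>U. {f u, x} \<notin> edges H"
    by (auto simp: forbidden_def)
  then have "\<forall>u\<in>U. {x, f u} \<notin> edges H" by (simp add: insert_commute)
  moreover have "{x} \<notin> edges H" using edge_ends(1)[OF fold_coverD(1)[OF c], of x x] by auto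
  ultimately have "partial_coloring G L H (insert w U) (f(w := x))"
    using p w x unfolding partial_coloring_def by auto
  then show ?thesis ..
qed

lemma partial_coloring_greedy:
  assumes c: "fold_cover m G L H" and p: "partial_coloring G L H U f"
    and w: "w \<in> verts G" "w \<notin> U"
    and less: "(\<Sum>u\<in>U. of_bool ({u, w} \<in> edges G)) < m"
  shows "\<exists>x. partial_coloring G L H (insert w U) (f(w := x))"
proof (rule partial_coloring_extend[OF c p w])
  note p' = p[unfolded partial_coloring_def]
  have "card (\<Union>u\<in>U. forbidden L H w (f u)) \<le> (\<Sum>u\<in>U. card (forbidden L H w (f u)))"
    using p' by (intro card_UN_le) auto
  also have "\<dots> \<le> (\<Sum>u\<in>U. of_bool ({u, w} \<in> edges G))"
    using p' w by (intro sum_mono card_forbidden_le[OF c]) auto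
  finally show "card (\<Union>u\<in>U. forbidden L H w (f u)) < m" using less by simp
qed

text \<open>The condition mentions \<open>G\<close> but no cover, so for an explicit graph and list
  it is checked once, by evaluation, for all covers.\<close>

fun greedy_order :: "nat \<Rightarrow> 'a graph \<Rightarrow> 'a set \<Rightarrow> 'a list \<Rightarrow> bool" where
  "greedy_order m G U [] \<longleftrightarrow> True"
| "greedy_order m G U (w # ws) \<longleftrightarrow> w \<in> verts G \<and> w \<notin> U \<and>
     (\<Sum>u\<in>U. of_bool ({u, w} \<in> edges G)) < m \<and> greedy_order m G (insert w U) ws"

text \<open>Agreement with \<open>f\<close> on \<open>U\<close> keeps colours that were picked
  deliberately before the greedy phase.\<close>

lemma partial_coloring_greedy_order:
  assumes "fold_cover m G L H" "partial_coloring G L H U f" "greedy_order m G U ws"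
  shows "\<exists>g. partial_coloring G L H (U \<union> set ws) g \<and> (\<forall>u\<in>U. g u = f u)"
  using assms(2,3)
proof (induction ws arbitrary: U f)
  case (Cons w ws)
  then obtain x where x: "partial_coloring G L H (insert w U) (f(w := x))"
    using partial_coloring_greedy[OF assms(1) Cons.prems(1), of w] by auto
  obtain g where g: "partial_coloring G L H (insert w U \<union> set ws) g"
    "\<forall>u\<in>insert w U. g u = (f(w := x)) u"
    using Cons.IH[OF x] Cons.prems(2) by auto
  have "insert w U \<union> set ws = U \<union> set (w # ws)" by auto
  moreover have "\<forall>u\<in>U. g u = f u" using g(2) Cons.prems(2) by auto
  ultimately show ?case using g(1) by auto
qed auto

text \<open>If some colour of \<open>x\<close> or \<open>y\<close> forbids nothing at
  \<open>v\<close>, it is taken, and any colour of the other vertex forbids at most one. Otherwise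
  the matchings from \<open>L x\<close> and from \<open>L y\<close> both cover \<open>L v\<close>,
  and the partners of one common \<open>z\<close> in \<open>L v\<close> are taken.\<close>

lemma forbid_common_color:
  assumes c: "fold_cover m G L H" and "0 < m"
    and v: "v \<in> verts G" and x: "x \<in> verts G" "x \<noteq> v" and y: "y \<in> verts G" "y \<noteq> v"
  shows "\<exists>a\<in>L x. \<exists>b\<in>L y. card (forbidden L H v a \<union> forbidden L H v b) \<le> 1"
proof -
  have ne: "L u \<noteq> {}" if "u \<in> verts G" for u using fold_coverD(2)[OF c that] \<open>0 < m\<close> by auto
  have le: "card (forbidden L H v a) \<le> 1" if "a \<in> L u" "u \<in> verts G" "u \<noteq> v" for a u
    using card_forbidden_le[OF c that(2) v that(3,1)] by (auto simp: of_bool_def split: if_splits)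
  have fin: "finite (forbidden L H v a)" for a
    using fold_coverD(4)[OF c v] by (simp add: forbidden_def)
  have all: "\<exists>a\<in>L u. forbidden L H v a = {z}"
    if u: "u \<in> verts G" "u \<noteq> v" and "z \<in> L v" and "\<forall>a\<in>L u. forbidden L H v a \<noteq> {}" for u z
  proof -
    have "\<exists>z. forbidden L H v a = {z}" if "a \<in> L u" for a
    proof -
      have "card (forbidden L H v a) \<noteq> 0" using fin that \<open>\<forall>a\<in>L u. forbidden L H v a \<noteq> {}\<close> by simp
      then have "card (forbidden L H v a) = 1" using le[OF that u] by simp
      then show ?thesis by (rule card_1_singletonE) auto
    qed
    then obtain h where h: "\<And>a. a \<in> L u \<Longrightarrow> forbidden L H v a = {h a}" by metis
    \<comment> \<open>Two colours of \<open>u\<close> with the same image would both be matched to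
      it. Since both lists have \<open>m\<close> elements, the injection \<open>h\<close> is onto
      \<open>L v\<close> and so reaches \<open>z\<close>.\<close>
    have "inj_on h (L u)"
    proof (rule inj_onI)
      fix a a' assume a: "a \<in> L u" "a' \<in> L u" "h a = h a'"
      then have "h a \<in> L v" "{h a, a} \<in> edges H" "{h a, a'} \<in> edges H"
        using h[OF a(1)] h[OF a(2)] by (auto simp: forbidden_def insert_commute)
      then show "a = a'" using cover_edge_unique[OF c v u(1) u(2)[symmetric]] a(1,2) by blast
    qed
    moreover have "h ` L u \<subseteq> L v" using h by (auto simp: forbidden_def)
    ultimately have "h ` L u = L v"
      using fold_coverD(2,4)[OF c] u(1) v by (metis card_image card_subset_eq)
    then obtain a where "a \<in> L u" "z = h a" using \<open>z \<in> L v\<close> by blast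
    then show ?thesis using h by blast
  qed
  obtain z where z: "z \<in> L v" using ne[OF v] by auto
  show ?thesis
  proof (cases "(\<exists>a\<in>L x. forbidden L H v a = {}) \<or> (\<exists>b\<in>L y. forbidden L H v b = {})")
    case True
    then show ?thesis
    proof
      assume "\<exists>a\<in>L x. forbidden L H v a = {}"
      then obtain a where a: "a \<in> L x" "forbidden L H v a = {}" by blast
      obtain b where b: "b \<in> L y" using ne[OF y(1)] by blast
      show ?thesis using a b le[OF b y] by (intro bexI[of _ a] bexI[of _ b]) simp_all
    next
      assume "\<exists>b\<in>L y. forbidden L H v b = {}"
      then obtain b where b: "b \<in> L y" "forbidden L H v b = {}" by blast
      obtain a where a: "a \<in> L x" using ne[OF x(1)] by blast
      show ?thesis using a b le[OF a x] by (intro bexI[of _ a] bexI[of _ b]) simp_all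
    qed
  next
    case False
    then obtain a b where "a \<in> L x" "b \<in> L y" "forbidden L H v a = {z}" "forbidden L H v b = {z}"
      using all[OF x z] all[OF y z] by blast
    then show ?thesis by (intro bexI[of _ a] bexI[of _ b]) auto
  qed
qed

section \<open>The cube\<close>

lemma verts_cube3:
  "verts (cube_graph 3) = {[False,False,False], [False,False,True], [False,True,False],
     [False,True,True], [True,False,False], [True,False,True], [True,True,False], [True,True,True]}"
proof -
  have "length x = 3 \<longleftrightarrow> (\<exists>a b c. x = [a, b, c])" for x :: "bool list"
    by (auto simp: numeral_3_eq_3 length_Suc_conv)
  then have "verts (cube_graph 3) = {x. \<exists>a b c. x = [a, b, c]}"
    by (simp add: cube_graph_def Let_def)
  then show ?thesis by (auto simp: ex_bool_eq)
qed

lemma card_verts_cube3: "card (verts (cube_graph 3)) = 8"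
  by (simp add: verts_cube3)

text \<open>Adjacency of explicit triples becomes arithmetic on their Hamming distance, which lets
  simp evaluate \<open>greedy_order\<close> on the cube.\<close>

lemma edge_cube3_iff [simp]:
  "{[a, b, c], [d, e, f]} \<in> edges (cube_graph 3) \<longleftrightarrow>
     of_bool (a \<noteq> d) + of_bool (b \<noteq> e) + of_bool (c \<noteq> f) = (1 :: nat)"
proof -
  define k where "k x y = card {i. i < 3 \<and> x ! i \<noteq> (y ! i :: bool)}" for x y
  have k_sym: "k x y = k y x" for x y by (simp add: k_def eq_commute)
  have "edges (cube_graph 3) = {{x, y} | x y. length x = 3 \<and> length y = 3 \<and> k x y = 1}"
    by (simp add: cube_graph_def k_def)
  then have "{x, y} \<in> edges (cube_graph 3) \<longleftrightarrow> length x = 3 \<and> length y = 3 \<and> k x y = 1" for x y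
    using k_sym[of x y] by (auto simp: doubleton_eq_iff)
  then have "{[a, b, c], [d, e, f]} \<in> edges (cube_graph 3) \<longleftrightarrow> k [a, b, c] [d, e, f] = 1"
    by simp
  moreover have "{i. i < 3 \<and> [a, b, c] ! i \<noteq> [d, e, f] ! i} =
      (if a \<noteq> d then {0} else {}) \<union> (if b \<noteq> e then {1} else {}) \<union> (if c \<noteq> f then {2} else {})"
    by (auto simp: less_Suc_eq numeral_3_eq_3 numeral_2_eq_2)
  ultimately show ?thesis by (simp add: k_def)
qed

section \<open>Five independent vertices in every 2-fold cover\<close>

lemma cube3_indep_number_ge:
  assumes c: "fold_cover 2 (cube_graph 3) L H"
  shows "5 \<le> indep_number H"
proof -
  \<comment> \<open>The vertex 011, its three neighbours and its antipode 100 induce a star plus an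
    isolated vertex. In this order each vertex has at most one earlier neighbour.\<close>
  let ?ws = "[[False,True,True], [False,True,False], [False,False,True], [True,True,True],
      [True,False,False]]"
  have p: "partial_coloring (cube_graph 3) L H {} undefined" by (simp add: partial_coloring_def)
  have "greedy_order 2 (cube_graph 3) {} ?ws"
    by (simp add: verts_cube3)
  then obtain g where g: "partial_coloring (cube_graph 3) L H (set ?ws) g"
    using partial_coloring_greedy_order[OF c p, of ?ws] unfolding Un_empty_left by blast
  have "card (g ` set ?ws) = 5" using partial_coloring_indep(2)[OF c g] by simp
  then show ?thesis
    using card_le_indep_number[OF fold_coverD(1)[OF c] partial_coloring_indep(1)[OF c g]] by simp
qed

section \<open>Upper bound 3 for the DP-chromatic number\<close>

lemma cube3_colorable3: "DP_colorable 3 (cube_graph 3)"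
  unfolding DP_colorable_def
proof (intro allI impI)
  fix L :: "bool list \<Rightarrow> nat set" and H assume c: "fold_cover 3 (cube_graph 3) L H"
  let ?G = "cube_graph 3"
  let ?v = "[False,False,False]" and ?x = "[True,False,False]" and ?y = "[False,True,False]"
  let ?z = "[False,False,True]"
  \<comment> \<open>Each listed vertex has a neighbour that is still uncoloured at its turn, a later
    vertex of the list or finally \<open>?v\<close>. As the cube is 3-regular, at most two
    neighbours are coloured by then.\<close>
  let ?ws = "[[True,True,False], [True,True,True], [False,True,True], [True,False,True], ?z]"
  obtain a b where a: "a \<in> L ?x" and b: "b \<in> L ?y"
    and ab: "card (forbidden L H ?v a \<union> forbidden L H ?v b) \<le> 1"
    using forbid_common_color[OF c, of ?v ?x ?y] by (auto simp: verts_cube3)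
  have xy: "{a, b} \<notin> edges H"
    using cover_edge_adj[OF c _ _ _ a b] by (auto simp: verts_cube3)
  have single: "{d} \<notin> edges H" for d
    using edge_ends(1)[OF fold_coverD(1)[OF c], of d d] by auto
  define f where "f = (\<lambda>u. if u = ?x then a else b)"
  have p: "partial_coloring ?G L H {?x, ?y} f"
    using a b xy single by (auto simp: partial_coloring_def f_def verts_cube3 insert_commute)
  have "greedy_order 3 ?G {?x, ?y} ?ws"
    by (simp add: verts_cube3)
  then obtain g where g: "partial_coloring ?G L H ({?x, ?y} \<union> set ?ws) g"
    and "\<forall>u\<in>{?x, ?y}. g u = f u"
    using partial_coloring_greedy_order[OF c p, of ?ws] by blast
  then have gf: "g ?x = a" "g ?y = b" by (simp_all add: f_def)
  let ?U = "{?x, ?y} \<union> set ?ws"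
  have g': "\<forall>u\<in>?U. g u \<in> L u" using g by (simp add: partial_coloring_def)
  have le: "card (forbidden L H ?v (g u)) \<le> of_bool ({u, ?v} \<in> edges ?G)" if "u \<in> ?U" for u
    using that g' by (intro card_forbidden_le[OF c]) (auto simp: verts_cube3)
  have fin: "finite (forbidden L H ?v d)" for d
    using fold_coverD(4)[OF c, of ?v] by (simp add: forbidden_def verts_cube3)
  \<comment> \<open>\<open>butlast\<close> drops \<open>?z\<close>; the other four listed vertices
    are not adjacent to \<open>?v\<close>.\<close>
  have none: "forbidden L H ?v (g u) = {}" if "u \<in> set (butlast ?ws)" for u
    using that le[of u] fin by (auto simp del: Un_iff)
  \<comment> \<open>All three neighbours of \<open>?v\<close> are coloured, but \<open>a\<close> and
    \<open>b\<close> together forbid at most one colour and the colour of \<open>?z\<close> at most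
    one more, so one of three colours stays free.\<close>
  have "(\<Union>u\<in>?U. forbidden L H ?v (g u)) =
      (forbidden L H ?v a \<union> forbidden L H ?v b) \<union> forbidden L H ?v (g ?z)"
    using none gf by auto
  also have "card \<dots> \<le> 1 + 1"
    using le[of ?z] by (intro order_trans[OF card_Un_le] add_mono ab) simp
  finally have "card (\<Union>u\<in>?U. forbidden L H ?v (g u)) < 3" by simp
  then obtain d where d: "partial_coloring ?G L H (insert ?v ?U) (g(?v := d))"
    using partial_coloring_extend[OF c g, of ?v] by (auto simp: verts_cube3)
  have V: "insert ?v ?U = verts ?G" by (auto simp: verts_cube3)
  show "\<exists>I. cover_coloring ?G H I"
    unfolding cover_coloring_def
    by (rule exI, rule conjI, rule partial_coloring_indep(1)[OF c d[unfolded V]],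
        rule partial_coloring_indep(2)[OF c d[unfolded V]])
qed

section \<open>Lower bound 2 for the DP-chromatic number\<close>

lemma fold_cover_trivial:
  assumes "is_graph G"
  shows "fold_cover 1 G (\<lambda>u. {u}) G"
proof -
  have m: "edges_between G {u} {v} \<subseteq> {{u, v}}" if "u \<noteq> v" for u v
  proof
    fix e assume e: "e \<in> edges_between G {u} {v}"
    then have "card e = 2" "{u, v} \<subseteq> e" using assms by (auto simp: edges_between_def is_graph_def)
    then have "e = {u, v}"
      using that by (metis card_2_iff card_subset_eq card.infinite zero_neq_numeral)
    then show "e \<in> {{u, v}}" by simp
  qed
  then have "matching (edges_between G {u} {v})" if "{u, v} \<in> edges G" for u v
    using edge_ends(1)[OF assms that] unfolding matching_def by blast
  moreover have "edges_between G {u} {v} = {}" if "u \<noteq> v" "{u, v} \<notin> edges G" for u v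
    using m[OF that(1)] that(2) by (auto simp: edges_between_def)
  ultimately show ?thesis
    using assms by (auto simp: fold_cover_def DP_cover_def disjoint_family_on_def clique_def)
qed

text \<open>In the cover of \<open>G\<close> by itself with singleton lists, a colouring would be
  all of \<open>verts G\<close>, which contains both ends of an edge.\<close>

lemma not_DP_colorable_1:
  assumes G: "is_graph G" and e: "{u, v} \<in> edges G"
  shows "\<not> DP_colorable 1 G"
proof
  assume "DP_colorable 1 G"
  then have "\<exists>I. cover_coloring G G I"
    using fold_cover_nat[OF fold_cover_trivial[OF G]] unfolding DP_colorable_def by metis
  then obtain I where "indep_set G I" "card I = card (verts G)"
    by (auto simp: cover_coloring_def)
  moreover from this have "I = verts G"
    using G by (simp add: indep_set_def is_graph_def card_subset_eq)
  ultimately show False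
    using edge_ends[OF G e] e by (auto simp: indep_set_def indep_def)
qed

text \<open>The lower bound admits \<open>t = 2\<close> in the definition of niceness; the upper
  bound makes the value required there exceed 5.\<close>

lemma DP_chromatic_number_cube3: "DP_chromatic_number (cube_graph 3) \<in> {2..3}"
proof -
  let ?P = "\<lambda>m. 1 \<le> m \<and> DP_colorable m (cube_graph 3)"
  have P3: "?P 3" using cube3_colorable3 by simp
  have "\<not> ?P 1"
    using not_DP_colorable_1[OF is_graph_cube, of "[False,False,False]" "[False,False,True]" 3]
    by simp
  moreover have "?P (LEAST m. ?P m)" using P3 by (rule LeastI)
  moreover have "(LEAST m. ?P m) \<le> 3" using P3 by (rule Least_le)
  ultimately show ?thesis
    unfolding DP_chromatic_number_def by (cases "(LEAST m. ?P m) = 1") auto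
qed

section \<open>Signed double covers\<close>

text \<open>The colours are two signs and \<open>N\<close> is the set of negative edges. A positive
  edge joins equal signs and a negative edge opposite signs, so in an independent set the sign
  changes exactly along positive edges.\<close>

definition signed_adj :: "'a graph \<Rightarrow> 'a set set \<Rightarrow> 'a \<times> bool \<Rightarrow> 'a \<times> bool \<Rightarrow> bool" where
  "signed_adj G N p q \<longleftrightarrow> fst p = fst q \<and> snd p \<noteq> snd q \<or>
     {fst p, fst q} \<in> edges G \<and> (snd p \<noteq> snd q \<longleftrightarrow> {fst p, fst q} \<in> N)"

definition signed_cover :: "'a graph \<Rightarrow> 'a set set \<Rightarrow> ('a \<times> bool) graph" where
  "signed_cover G N = (verts G \<times> UNIV,
     {{p, q} | p q. p \<in> verts G \<times> UNIV \<and> q \<in> verts G \<times> UNIV \<and> signed_adj G N p q})"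

lemma signed_cover_edge_iff:
  "{p, q} \<in> edges (signed_cover G N) \<longleftrightarrow>
     p \<in> verts G \<times> UNIV \<and> q \<in> verts G \<times> UNIV \<and> signed_adj G N p q"
proof -
  have "signed_adj G N p q \<longleftrightarrow> signed_adj G N q p" for p q
    by (auto simp: signed_adj_def insert_commute)
  then show ?thesis by (auto simp: signed_cover_def doubleton_eq_iff)
qed

lemma fold_cover_signed_cover:
  assumes G: "is_graph G"
  shows "fold_cover 2 G (\<lambda>u. {u} \<times> UNIV) (signed_cover G N)"
proof -
  let ?H = "signed_cover G N" and ?L = "\<lambda>u. {u} \<times> (UNIV :: bool set)"
  have loop: "{u} \<notin> edges G" for u using edge_ends(1)[OF G, of u u] by auto
  have "card e = 2" if e: "e \<in> edges ?H" for e
  proof -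
    obtain p q where "e = {p, q}" "signed_adj G N p q"
      using e unfolding signed_cover_def snd_conv by blast
    moreover from this have "p \<noteq> q" using loop by (auto simp: signed_adj_def)
    ultimately show ?thesis by simp
  qed
  moreover have "e \<subseteq> verts ?H" if "e \<in> edges ?H" for e
    using that by (auto simp: signed_cover_def)
  ultimately have "is_graph ?H"
    using G by (simp add: is_graph_def signed_cover_def)
  moreover have "clique (?L u) (edges ?H)" if "u \<in> verts G" for u
    using that by (auto simp: clique_def signed_cover_edge_iff signed_adj_def)
  \<comment> \<open>The term \<open>a = ({u, v} \<notin> N)\<close> is \<open>a\<close> on a
    positive edge and its negation on a negative one. An edge between the two lists is thus
    determined by its sign at either end, which gives the matching.\<close>
  moreover have between: "\<exists>a. e = {(u, a), (v, a = ({u, v} \<notin> N))} \<and> {u, v} \<in> edges G"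
    if "u \<noteq> v" "e \<in> edges_between ?H (?L u) (?L v)" for u v e
  proof -
    have e: "e \<in> edges ?H" and "e \<inter> ?L u \<noteq> {}" "e \<inter> ?L v \<noteq> {}"
      using that(2) by (auto simp: edges_between_def)
    then obtain a b where ab: "(u, a) \<in> e" "(v, b) \<in> e" by auto
    obtain p q where "e = {p, q}" using e by (auto simp: signed_cover_def)
    then have eab: "e = {(u, a), (v, b)}"
      using ab \<open>u \<noteq> v\<close> unfolding \<open>e = {p, q}\<close> by auto
    then have "signed_adj G N (u, a) (v, b)" using e signed_cover_edge_iff by metis
    then have "{u, v} \<in> edges G" "b = (a = ({u, v} \<notin> N))"
      using \<open>u \<noteq> v\<close> by (auto simp: signed_adj_def)
    then show ?thesis using eab by auto
  qed
  moreover have "matching (edges_between ?H (?L u) (?L v))" if "{u, v} \<in> edges G" for u v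
    unfolding matching_def
  proof (intro ballI impI)
    have ne: "u \<noteq> v" using edge_ends(1)[OF G that] .
    fix e e' assume e: "e \<in> edges_between ?H (?L u) (?L v)" "e' \<in> edges_between ?H (?L u) (?L v)"
      and "e \<noteq> e'"
    obtain a a' where "e = {(u, a), (v, a = ({u, v} \<notin> N))}" "e' = {(u, a'), (v, a' = ({u, v} \<notin> N))}"
      using between[OF ne e(1)] between[OF ne e(2)] by auto
    then show "e \<inter> e' = {}" using \<open>e \<noteq> e'\<close> ne by (cases "a = a'") auto
  qed
  moreover have "edges_between ?H (?L u) (?L v) = {}" if "u \<noteq> v" "{u, v} \<notin> edges G" for u v
    using between[OF that(1)] that(2) by blast
  moreover have "(\<Union>u\<in>verts G. ?L u) = verts ?H" by (auto simp: signed_cover_def)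
  ultimately show ?thesis
    by (auto simp: fold_cover_def DP_cover_def disjoint_family_on_def card_cartesian_product)
qed

text \<open>The two signs over a vertex are adjacent, so an independent set is counted by the
  vertices of \<open>G\<close> that it occupies.\<close>

lemma signed_cover_card_indep:
  assumes "indep_set (signed_cover G N) S"
  shows "card S = card (fst ` S)"
proof -
  have "inj_on fst S"
  proof (rule inj_onI)
    fix p q assume pq: "p \<in> S" "q \<in> S" "fst p = fst q"
    then have "p \<noteq> q \<Longrightarrow> {p, q} \<notin> edges (signed_cover G N)"
      using assms by (simp add: indep_set_def indep_def)
    moreover have "S \<subseteq> verts G \<times> UNIV" using assms by (simp add: indep_set_def signed_cover_def)
    ultimately show "p = q"
      using pq by (auto simp: signed_cover_edge_iff signed_adj_def prod_eq_iff)
  qed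
  then show ?thesis by (simp add: card_image)
qed

lemma signed_cover_indep_edge:
  assumes S: "indep_set (signed_cover G N) S" and G: "is_graph G"
    and e: "{u, v} \<in> edges G" "u \<in> fst ` S" "v \<in> fst ` S"
  shows "((u, True) \<in> S \<longleftrightarrow> (v, True) \<in> S) \<longleftrightarrow> {u, v} \<in> N"
proof -
  have V: "S \<subseteq> verts G \<times> UNIV" using S by (simp add: indep_set_def signed_cover_def)
  have no: "\<not> signed_adj G N p q" if "p \<in> S" "q \<in> S" "p \<noteq> q" for p q
  proof -
    have "{p, q} \<notin> edges (signed_cover G N)"
      using S that by (simp add: indep_set_def indep_def)
    then show ?thesis using that V by (auto simp: signed_cover_edge_iff)
  qed
  obtain a b where ab: "(u, a) \<in> S" "(v, b) \<in> S" using e by auto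
  \<comment> \<open>Only one sign over \<open>w\<close> can occur in \<open>S\<close>, so membership
    of \<open>(w, True)\<close> reads it off.\<close>
  have "(w, True) \<in> S \<longleftrightarrow> c" if "(w, c) \<in> S" for w c
    using no[of "(w, c)" "(w, True)"] that by (cases c) (auto simp: signed_adj_def)
  then have "((u, True) \<in> S \<longleftrightarrow> (v, True) \<in> S) \<longleftrightarrow> a = b" using ab by auto
  moreover have "u \<noteq> v" using edge_ends(1)[OF G e(1)] .
  ultimately show ?thesis using no[OF ab] e(1) by (auto simp: signed_adj_def)
qed

section \<open>An unbalanced signing of the cube\<close>

text \<open>With these edges negative, every face has exactly one or three negative edges.\<close>

definition cube3_neg :: "bool list set set" where
  "cube3_neg = {{[True,False,False], [True,True,False]}, {[True,False,True], [True,True,True]},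
     {[True,False,False], [True,False,True]}, {[False,True,False], [False,True,True]}}"

lemma signed_cube3_card_indep_le:
  assumes S: "indep_set (signed_cover (cube_graph 3) cube3_neg) S"
  shows "card S \<le> 5"
proof -
  define W where "W a b c \<longleftrightarrow> [a, b, c] \<in> fst ` S" for a b c
  define C where "C a b c \<longleftrightarrow> ([a, b, c], True) \<in> S" for a b c
  have E: "(C a b c \<longleftrightarrow> C d e f) \<longleftrightarrow> {[a, b, c], [d, e, f]} \<in> cube3_neg"
    if "W a b c" "W d e f" "of_bool (a \<noteq> d) + of_bool (b \<noteq> e) + of_bool (c \<noteq> f) = (1 :: nat)"
    for a b c d e f
    using signed_cover_indep_edge[OF S is_graph_cube, of "[a, b, c]" "[d, e, f]"] that
    by (simp add: W_def C_def)
  \<comment> \<open>The signing by direction: edges in the first coordinate are all positive, in the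
    second negative iff \<open>a\<close> holds, in the third negative iff
    \<open>a \<noteq> b\<close>.\<close>
  have E': "W False b c \<Longrightarrow> W True b c \<Longrightarrow> C False b c \<longleftrightarrow> \<not> C True b c"
    "W a False c \<Longrightarrow> W a True c \<Longrightarrow> (C a False c \<longleftrightarrow> C a True c) \<longleftrightarrow> a"
    "W a b False \<Longrightarrow> W a b True \<Longrightarrow> (C a b False \<longleftrightarrow> C a b True) \<longleftrightarrow> a \<noteq> b" for a b c
    using E[of False b c True b c] E[of a False c a True c] E[of a b False a b True]
    by (auto simp: cube3_neg_def doubleton_eq_iff)
  \<comment> \<open>Around a fully occupied face the sign would change once per positive edge, an
    odd number of times.\<close>
  have faces: "\<not> (W a False False \<and> W a False True \<and> W a True False \<and> W a True True)"
    "\<not> (W False b False \<and> W False b True \<and> W True b False \<and> W True b True)"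
    "\<not> (W False False c \<and> W False True c \<and> W True False c \<and> W True True c)" for a b c
    using E' by metis+
  \<comment> \<open>This is the 6-cycle avoiding \<open>[a, b, c]\<close> and its antipode. Its
    second-coordinate edges contribute one negative edge and its third-coordinate edges zero or two,
    so again the number of sign changes is odd.\<close>
  have hexagons: "\<not> (W a b (\<not> c) \<and> W a (\<not> b) (\<not> c) \<and> W a (\<not> b) c \<and>
      W (\<not> a) (\<not> b) c \<and> W (\<not> a) b c \<and> W (\<not> a) b (\<not> c))" for a b c
    using E'(1)[of b "\<not> c"] E'(1)[of "\<not> b" c] E'(2)[of a "\<not> c"] E'(2)[of "\<not> a" c]
      E'(3)[of a "\<not> b"] E'(3)[of "\<not> a" b]
    by (cases a; cases b; cases c) auto
  let ?n = "\<lambda>a b c. of_bool (W a b c) :: nat"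
  have "fst ` S \<subseteq> verts (cube_graph 3)"
    using S by (auto simp: indep_set_def signed_cover_def)
  then have "card (fst ` S) = (\<Sum>v\<in>verts (cube_graph 3). of_bool (v \<in> fst ` S))"
    by (simp add: verts_cube3 Int_absorb1 flip: Int_def sum.inter_filter)
  also have "\<dots> = ?n False False False + ?n False False True + ?n False True False +
      ?n False True True + ?n True False False + ?n True False True + ?n True True False +
      ?n True True True"
    by (simp add: verts_cube3 W_def)
  \<comment> \<open>The instances cover all six faces and, by fixing the first argument to
    \<open>False\<close>, one hexagon for each of the four antipodal pairs.\<close>
  also have "\<dots> \<le> 5"
    using faces[of False] faces[of True] hexagons[of False False False] hexagons[of False False True]
      hexagons[of False True False] hexagons[of False True True]
    by (cases "W False False False"; cases "W False False True"; cases "W False True False";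
        cases "W False True True"; cases "W True False False"; cases "W True False True";
        cases "W True True False"; simp)
  finally show ?thesis using signed_cover_card_indep[OF S] by simp
qed

section \<open>The exact value 5 and the failure of niceness\<close>

lemma partial_DP_number_cube3: "partial_DP_number 2 (cube_graph 3) = 5"
  unfolding partial_DP_number_def
proof (rule Least_equality)
  let ?K = "signed_cover (cube_graph 3) cube3_neg"
  have c: "fold_cover 2 (cube_graph 3) (\<lambda>u. {u} \<times> UNIV) ?K"
    by (rule fold_cover_signed_cover[OF is_graph_cube])
  have "indep_number ?K = 5"
    using indep_number_leI[OF fold_coverD(1)[OF c] signed_cube3_card_indep_le]
      cube3_indep_number_ge[OF c] by simp
  \<comment> \<open>The signed cover has vertices in \<open>bool list \<times> bool\<close>;
    \<open>fold_cover_nat\<close> copies it to natural numbers with the same independence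
    number.\<close>
  then show "\<exists>(L :: bool list \<Rightarrow> nat set) H.
      fold_cover 2 (cube_graph 3) L H \<and> 5 = indep_number H"
    using fold_cover_nat[OF c] by metis
qed (use cube3_indep_number_ge in auto)

theorem lemma11:
  shows "\<not> partially_DP_nice (cube_graph 3) \<and> partial_DP_number 2 (cube_graph 3) = 5"
proof -
  let ?k = "DP_chromatic_number (cube_graph 3)"
  have k: "2 \<le> ?k" "?k \<le> 3" using DP_chromatic_number_cube3 by auto
  \<comment> \<open>With \<open>?k\<close> at most 3 the quotient is at least 16/3, so niceness
    already fails at \<open>t = 2\<close>.\<close>
  have "\<not> 5 \<ge> 2 * 8 / real ?k" using k by (simp add: field_simps)
  then have "\<not> partially_DP_nice (cube_graph 3)"
    using k by (auto simp: partially_DP_nice_def partial_DP_number_cube3 card_verts_cube3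
        intro!: bexI[of _ 2])
  then show ?thesis using partial_DP_number_cube3 by simp
qed

end
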